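(* Let $\alpha,\beta\in\mathbb{C}$ and $k$ a positive integer such that $k\alpha+k\beta+1$ is not zero or a negative integer. Then \[ \binom{k\alpha+k\beta+\beta}{\beta}\,{}_2F_1(\alpha,-\beta;k\alpha+k\beta+1;-1)=\sum_{i\ge0}\binom{k\alpha+k\beta+\beta}{\beta-i}\frac{(\alpha)_i}{i!}. \]
   Context: Here $\binom{x}{y}$ denotes the extended binomial coefficient $\frac{\Gamma(x+1)}{\Gamma(y+1)\Gamma(x-y+1)}$; $(x)_0=1$ and $(x)_i=x(x+1)\cdots(x+i-1)$ is the rising Pochhammer symbol; ${}_2F_1(a,b;c;z)=\sum_{m\ge0}\frac{(a)_m(b)_m}{(c)_m}\frac{z^m}{m!}$ is the Gauss hypergeometric function. *)

theory Defs
  imports "HOL-Analysis.Analysis"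
begin

text \<open>
  Library conventions put \<open>Gamma\<close> at a pole equal to \<open>0\<close> and \<open>x / 0 = 0\<close>. For a pole in the
  denominator this agrees with the usual reading \<open>1 / \<Gamma> = 0\<close>. If \<open>x\<close> is a negative integer,
  the numerator has a pole, the coefficient is not defined mathematically, and the value here is
  the default \<open>0\<close>.
\<close>

definition ext_binomial :: "complex \<Rightarrow> complex \<Rightarrow> complex" where
  "ext_binomial x y = Gamma (x + 1) / (Gamma (y + 1) * Gamma (x - y + 1))"

definition hypergeom_2F1_term ::
    "complex \<Rightarrow> complex \<Rightarrow> complex \<Rightarrow> complex \<Rightarrow> nat \<Rightarrow> complex" where
  "hypergeom_2F1_term a b c z m =
     pochhammer a m * pochhammer b m / pochhammer c m * (z ^ m / fact m)"

text \<open>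
  The sum of the series itself, not its analytic continuation: on \<open>norm z = 1\<close> it is meaningful
  only together with \<open>summable (hypergeom_2F1_term a b c z)\<close>.
\<close>

definition hypergeom_2F1 :: "complex \<Rightarrow> complex \<Rightarrow> complex \<Rightarrow> complex \<Rightarrow> complex" where
  "hypergeom_2F1 a b c z = (\<Sum>m. hypergeom_2F1_term a b c z m)"

end

theory Submission
  imports Defs
begin

text \<open>
  The two series agree term by term: \<open>rGamma z = pochhammer z i * rGamma (z + i)\<close>, which also
  holds at the poles of \<open>Gamma\<close>, turns the coefficient at \<open>\<beta> - i\<close> into the coefficient at \<open>\<beta>\<close>
  times a quotient of Pochhammer symbols.
\<close>

text \<open>Since \<open>rGamma\<close> is entire, both denominators become factors that can be
  shifted without a case split at the poles of \<open>Gamma\<close>.\<close>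

lemma ext_binomial_rGamma:
  "ext_binomial x y = Gamma (x + 1) * rGamma (y + 1) * rGamma (x - y + 1)"
  by (simp add: ext_binomial_def rGamma_inverse_Gamma field_simps)

text \<open>The factor \<open>Gamma (x + 1)\<close> does not depend on \<open>i\<close>, so its
  default 0 at a pole is harmless. The hypothesis is what permits division by
  \<open>pochhammer (x - y + 1) i\<close>.\<close>

lemma ext_binomial_diff_of_nat:
  assumes "x - y + 1 \<notin> \<int>\<^sub>\<le>\<^sub>0"
  shows "ext_binomial x (y - of_nat i) =
    ext_binomial x y * ((- 1) ^ i * pochhammer (- y) i / pochhammer (x - y + 1) i)"
proof -
  have "rGamma (y - of_nat i + 1) = pochhammer (y - of_nat i + 1) i * rGamma (y + 1)"
    using pochhammer_rGamma[of "y - of_nat i + 1" i] by (simp add: algebra_simps)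
  moreover have "pochhammer (- y) i = (- 1) ^ i * pochhammer (y - of_nat i + 1) i"
    by (rule pochhammer_minus)
  \<comment> \<open>The two signs \<open>(- 1) ^ i\<close> multiply to 1.\<close>
  ultimately have num: "rGamma (y - of_nat i + 1) = (- 1) ^ i * pochhammer (- y) i * rGamma (y + 1)"
    by (simp flip: mult.assoc power_mult_distrib)
  have "pochhammer (x - y + 1) i \<noteq> 0"
    using assms by (auto simp: pochhammer_eq_0_iff)
  then have "rGamma (x - (y - of_nat i) + 1) = rGamma (x - y + 1) / pochhammer (x - y + 1) i"
    using pochhammer_rGamma[of "x - y + 1" i] by (simp add: field_simps)
  with num show ?thesis
    by (simp add: ext_binomial_rGamma)
qed

text \<open>The sign left by reflecting the Pochhammer symbol is the power \<open>z ^ i\<close> at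
  \<open>z = - 1\<close>.\<close>

lemma ext_binomial_mult_hypergeom_2F1_term:
  assumes "x - y + 1 \<notin> \<int>\<^sub>\<le>\<^sub>0"
  shows "ext_binomial x (y - of_nat i) * (pochhammer a i / fact i) =
    ext_binomial x y * hypergeom_2F1_term a (- y) (x - y + 1) (- 1) i"
  by (simp add: ext_binomial_diff_of_nat[OF assms] hypergeom_2F1_term_def)

theorem theorem3p4:
  fixes \<alpha> \<beta> :: complex and k :: nat
  assumes "k > 0"
    and "of_nat k * \<alpha> + of_nat k * \<beta> + 1 \<notin> \<int>\<^sub>\<le>\<^sub>0"
  shows
    "(summable (\<lambda>i. ext_binomial (of_nat k * \<alpha> + of_nat k * \<beta> + \<beta>) (\<beta> - of_nat i)
                      * (pochhammer \<alpha> i / fact i))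
      \<longleftrightarrow> ext_binomial (of_nat k * \<alpha> + of_nat k * \<beta> + \<beta>) \<beta> = 0
          \<or> summable (hypergeom_2F1_term \<alpha> (- \<beta>) (of_nat k * \<alpha> + of_nat k * \<beta> + 1) (- 1)))
     \<and>
     (summable (\<lambda>i. ext_binomial (of_nat k * \<alpha> + of_nat k * \<beta> + \<beta>) (\<beta> - of_nat i)
                      * (pochhammer \<alpha> i / fact i))
      \<longrightarrow> ext_binomial (of_nat k * \<alpha> + of_nat k * \<beta> + \<beta>) \<beta>
            * hypergeom_2F1 \<alpha> (- \<beta>) (of_nat k * \<alpha> + of_nat k * \<beta> + 1) (- 1)
          = (\<Sum>i. ext_binomial (of_nat k * \<alpha> + of_nat k * \<beta> + \<beta>) (\<beta> - of_nat i)
                     * (pochhammer \<alpha> i / fact i)))"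
proof -
  define x c B where "x = of_nat k * \<alpha> + of_nat k * \<beta> + \<beta>"
    and "c = of_nat k * \<alpha> + of_nat k * \<beta> + 1" and "B = ext_binomial x \<beta>"
  \<comment> \<open>This turns the pole condition of the termwise identity into the assumption on
    the lower parameter.\<close>
  have c: "x - \<beta> + 1 = c"
    by (simp add: x_def c_def)
  have "(\<lambda>i. ext_binomial x (\<beta> - of_nat i) * (pochhammer \<alpha> i / fact i)) =
      (\<lambda>i. B * hypergeom_2F1_term \<alpha> (- \<beta>) c (- 1) i)"
    using ext_binomial_mult_hypergeom_2F1_term[of x \<beta>] assms(2) by (simp add: c B_def c_def)
  then show ?thesis
    unfolding hypergeom_2F1_def x_def[symmetric] c_def[symmetric] B_def[symmetric]
    \<comment> \<open>If \<open>B = 0\<close>, the right-hand series is identically zero and the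
      left side is 0 even where the hypergeometric series diverges. Otherwise the constant
      \<open>B\<close> affects neither summability nor the identity.\<close>
    by (cases "B = 0") (simp_all add: summable_cmult_iff suminf_mult)
qed

end
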